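(* Let $q=p^n$, $p$ prime, and let $\mathcal A$ be a proper subset of the points of a projective plane $\Pi_q$ of order $q$ such that for every point $R\in\mathcal A$ there exist integers $0\le m_R,t_R\le p-1$ such that at most one line through $R$ meets $\mathcal A$ in a number of points congruent to $t_R \pmod p$, and all other lines through $R$ meet $\mathcal A$ in a number of points congruent to $m_R\pmod p$. Call $R\in\mathcal A$ regular if it is incident with exactly one line meeting $\mathcal A$ in $t_R \pmod p$ points and with $q$ lines meeting $\mathcal A$ in $m_R\pmod p$ points (so $t_R\neq m_R$); this unique line is called the renitent line at $R$. The other points of $\mathcal A$ are called irregular. Then one of the following holds: (1) Every point of $\mathcal A$ is regular; then $t_P=t_R$ and $m_P=m_R$ for all $P,R\in\mathcal A$, i.e. $\mathcal A$ is a mod $p$ generalized KM-arc of type $(0,m,t)_p$ with $m\neq t$. (2) Every point of $\mathcal A$ is irregular, and hence $\mathcal A$ is a $c$ mod $p$ intersecting point set for some $c$. (3) There is a unique irregular point $Q$, and all renitent lines are incident with $Q$. In this case $\mathcal A\setminus\{Q\}$ is either a mod $p$ generalized KM-arc of type $(0,m,t)_p$ with $m\ne t$ or a $c$ mod $p$ intersecting point set, and in the former case the proper $t_p$-secants of $\mathcal A\setminus\{Q\}$ are concurrent.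
   Context: For a point set $\mathcal S$, an $i_p$-secant ($0\le i\le p-1$) is a line meeting $\mathcal S$ in a number of points congruent to $i\pmod p$; it is proper if it meets $\mathcal S$ in at least one point. A mod $p$ generalized KM-arc of type $(0,m,t)_p$ in a projective plane of order $q=p^n$ is a proper non-empty point set $\mathcal S$ such that every point $R\in\mathcal S$ is incident with a $t_p$-secant and the other $q$ lines through $R$ are $m_p$-secants, where $0\le m,t\le p-1$. For $0\le c\le p-1$, a $c$ mod $p$ intersecting point set is a point set such that every line meeting it in at least one point meets it in a number of points congruent to $c\pmod p$. *)

theory Defs
  imports "HOL-Number_Theory.Cong"
begin

text \<open>Lines are identified with the sets of points incident with them.\<close>

locale projective_plane =
  fixes Pts :: "'a set" and Lns :: "'a set set"
  assumes line_subset: "l \<in> Lns \<Longrightarrow> l \<subseteq> Pts"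
    and join: "\<lbrakk>X \<in> Pts; Y \<in> Pts; X \<noteq> Y\<rbrakk> \<Longrightarrow> \<exists>!l. l \<in> Lns \<and> X \<in> l \<and> Y \<in> l"
    and meet: "\<lbrakk>l \<in> Lns; k \<in> Lns; l \<noteq> k\<rbrakk> \<Longrightarrow> \<exists>!X. X \<in> l \<and> X \<in> k"
    and quadrangle: "\<exists>F \<subseteq> Pts. card F = 4 \<and> (\<forall>l\<in>Lns. card (F \<inter> l) \<le> 2)"

locale projective_plane_of_order = projective_plane Pts Lns
  for Pts :: "'a set" and Lns :: "'a set set" and q :: nat +
  assumes card_line: "l \<in> Lns \<Longrightarrow> card l = q + 1"

definition mod_secant :: "'a set set \<Rightarrow> nat \<Rightarrow> 'a set \<Rightarrow> nat \<Rightarrow> 'a set \<Rightarrow> bool" where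
  "mod_secant Lns p S i l \<longleftrightarrow> l \<in> Lns \<and> [card (S \<inter> l) = i] (mod p)"

definition proper_mod_secant :: "'a set set \<Rightarrow> nat \<Rightarrow> 'a set \<Rightarrow> nat \<Rightarrow> 'a set \<Rightarrow> bool" where
  "proper_mod_secant Lns p S i l \<longleftrightarrow> mod_secant Lns p S i l \<and> S \<inter> l \<noteq> {}"

text \<open>The parameters \<open>m t\<close> are those of the type \<open>(0,m,t)\<^sub>p\<close>; \<open>m = t\<close> is permitted.\<close>

definition mod_KM_arc ::
    "'a set \<Rightarrow> 'a set set \<Rightarrow> nat \<Rightarrow> nat \<Rightarrow> nat \<Rightarrow> 'a set \<Rightarrow> bool" where
  "mod_KM_arc Pts Lns p m t S \<longleftrightarrow>
     S \<subset> Pts \<and> S \<noteq> {} \<and> m < p \<and> t < p \<and>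
     (\<forall>R\<in>S. \<exists>l. R \<in> l \<and> mod_secant Lns p S t l \<and>
        (\<forall>k\<in>Lns. R \<in> k \<and> k \<noteq> l \<longrightarrow> mod_secant Lns p S m k))"

definition mod_intersecting ::
    "'a set \<Rightarrow> 'a set set \<Rightarrow> nat \<Rightarrow> nat \<Rightarrow> 'a set \<Rightarrow> bool" where
  "mod_intersecting Pts Lns p c S \<longleftrightarrow>
     S \<subseteq> Pts \<and> c < p \<and> (\<forall>l\<in>Lns. S \<inter> l \<noteq> {} \<longrightarrow> mod_secant Lns p S c l)"

text \<open>In the next three definitions \<open>m R\<close> and \<open>t R\<close> are the residues attached to the point \<open>R\<close>.\<close>

definition regular_point ::
    "'a set set \<Rightarrow> nat \<Rightarrow> nat \<Rightarrow> 'a set \<Rightarrow> ('a \<Rightarrow> nat) \<Rightarrow> ('a \<Rightarrow> nat) \<Rightarrow> 'a \<Rightarrow> bool" where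
  "regular_point Lns p q A m t R \<longleftrightarrow>
     R \<in> A \<and>
     card {l. R \<in> l \<and> mod_secant Lns p A (t R) l} = 1 \<and>
     card {l. R \<in> l \<and> mod_secant Lns p A (m R) l} = q"

definition irregular_point ::
    "'a set set \<Rightarrow> nat \<Rightarrow> nat \<Rightarrow> 'a set \<Rightarrow> ('a \<Rightarrow> nat) \<Rightarrow> ('a \<Rightarrow> nat) \<Rightarrow> 'a \<Rightarrow> bool" where
  "irregular_point Lns p q A m t R \<longleftrightarrow> R \<in> A \<and> \<not> regular_point Lns p q A m t R"

definition renitent_line ::
    "'a set set \<Rightarrow> nat \<Rightarrow> nat \<Rightarrow> 'a set \<Rightarrow> ('a \<Rightarrow> nat) \<Rightarrow> ('a \<Rightarrow> nat) \<Rightarrow> 'a \<Rightarrow> 'a set \<Rightarrow> bool" where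
  "renitent_line Lns p q A m t R l \<longleftrightarrow>
     regular_point Lns p q A m t R \<and> R \<in> l \<and> mod_secant Lns p A (t R) l"

definition concurrent :: "'a set \<Rightarrow> 'a set set \<Rightarrow> bool" where
  "concurrent Pts K \<longleftrightarrow> (\<exists>X\<in>Pts. \<forall>l\<in>K. X \<in> l)"

end

theory Submission
  imports Defs
begin

text \<open>
  Counting \<open>A\<close> along the \<open>q + 1\<close> lines through a point \<open>R \<in> A\<close> gives
  \<open>\<Sum>\<^sub>l card (A \<inter> l) = card A + q\<close>. Since \<open>p\<close> divides \<open>q\<close>, reading this modulo \<open>p\<close> shows that
  \<open>t R\<close> is the residue \<open>a\<close> of \<open>card A\<close> if \<open>R\<close> is regular, and \<open>m R = a\<close> if \<open>R\<close> is irregular.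
  So a regular point lies on exactly one line of residue \<open>a\<close>, while every line through an
  irregular point has residue \<open>a\<close>; hence every line joining a regular point to an irregular one
  is renitent. This forces uniqueness of the irregular point as soon as a regular point exists,
  and deleting it lowers by one the residue of precisely the lines through it.
\<close>

section \<open>Lines and pencils in an arbitrary projective plane\<close>

context projective_plane
begin

definition pencil :: "'a \<Rightarrow> 'a set set" where
  "pencil R = {l \<in> Lns. R \<in> l}"

lemma line_eqI:
  assumes "l \<in> Lns" "k \<in> Lns" "X \<noteq> Y" "X \<in> l" "Y \<in> l" "X \<in> k" "Y \<in> k"
  shows "l = k"
proof -
  have "X \<in> Pts" "Y \<in> Pts"
    using assms line_subset by auto
  from join[OF this \<open>X \<noteq> Y\<close>] show ?thesis
    using assms by blast
qed

lemma obtain_join: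
  assumes "X \<in> Pts" "Y \<in> Pts" "X \<noteq> Y"
  obtains l where "l \<in> Lns" "X \<in> l" "Y \<in> l"
  using join[OF assms] by blast

lemma ex_pencil_line:
  assumes "R \<in> Pts" "X \<in> Pts" "R \<noteq> X"
  shows "\<exists>l\<in>pencil R. X \<in> l"
  using obtain_join[OF assms] by (auto simp: pencil_def)

text \<open>At least three points of the quadrangle differ from \<open>R\<close>, and they are not
  collinear. The lines joining one of them, \<open>x\<close>, to the other two are distinct and meet
  only in \<open>x\<close>, so \<open>R\<close> cannot lie on both.\<close>

lemma ex_line_not_through: "\<exists>l\<in>Lns. R \<notin> l"
proof -
  obtain F where F: "F \<subseteq> Pts" "card F = 4" "\<And>l. l \<in> Lns \<Longrightarrow> card (F \<inter> l) \<le> 2"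
    using quadrangle by blast
  have fin: "finite F"
    using F(2) by (intro card_ge_0_finite) simp
  have "3 \<le> card (F - {R})"
    using F(2) fin by (cases "R \<in> F") auto
  then obtain T where T: "T \<subseteq> F - {R}" "card T = 3"
    by (meson obtain_subset_with_card_n)
  then obtain x y z where xyz: "T = {x, y, z}" "x \<noteq> y" "x \<noteq> z" "y \<noteq> z"
    by (auto simp: card_3_iff)
  have pts: "x \<in> Pts" "y \<in> Pts" "z \<in> Pts" "x \<noteq> R"
    using T xyz F by auto
  obtain l where l: "l \<in> Lns" "x \<in> l" "y \<in> l"
    using obtain_join pts xyz by metis
  obtain k where k: "k \<in> Lns" "x \<in> k" "z \<in> k"
    using obtain_join pts xyz by metis
  have "l \<noteq> k"
  proof
    assume "l = k"
    then have "T \<subseteq> F \<inter> l"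
      using T xyz l k by auto
    then have "card T \<le> card (F \<inter> l)"
      using fin by (intro card_mono) auto
    then show False
      using T(2) F(3)[OF l(1)] by simp
  qed
  then show ?thesis
    using line_eqI[OF l(1) k(1) pts(4)] l k by blast
qed

text \<open>The bijection is the perspectivity sending \<open>X\<close> on \<open>k\<close> to the
  line \<open>RX\<close>; its inverse intersects a line of the pencil with \<open>k\<close>. It
  transfers the size of a line to the pencil.\<close>

lemma ex_pencil_bij:
  assumes "R \<in> Pts" "k \<in> Lns" "R \<notin> k"
  shows "\<exists>f. bij_betw f k (pencil R)"
proof -
  have "\<forall>X\<in>k. \<exists>l. l \<in> Lns \<and> R \<in> l \<and> X \<in> l"
    using assms line_subset obtain_join by (metis subsetD)
  then obtain f where f: "\<And>X. X \<in> k \<Longrightarrow> f X \<in> Lns \<and> R \<in> f X \<and> X \<in> f X"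
    by metis
  have "inj_on f k"
  proof (rule inj_onI)
    fix X Y
    assume "X \<in> k" "Y \<in> k" "f X = f Y"
    then show "X = Y"
      using f line_eqI[of "f X" k X Y] assms by metis
  qed
  moreover have "f ` k = pencil R"
  proof
    show "f ` k \<subseteq> pencil R"
      using f by (auto simp: pencil_def)
    show "pencil R \<subseteq> f ` k"
    proof
      fix l
      assume "l \<in> pencil R"
      then have l: "l \<in> Lns" "R \<in> l"
        by (auto simp: pencil_def)
      then obtain X where X: "X \<in> l" "X \<in> k"
        using meet[of l k] assms by blast
      then have "f X = l"
        using line_eqI[of "f X" l R X] f l assms by metis
      then show "l \<in> f ` k"
        using X by blast
    qed
  qed
  ultimately show ?thesis
    by (auto simp: bij_betw_def)
qed

end

section \<open>Counting in a plane of finite order\<close>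

context projective_plane_of_order
begin

lemma finite_line: "l \<in> Lns \<Longrightarrow> finite l"
  using card_line by (intro card_ge_0_finite) simp

lemma card_pencil:
  assumes "R \<in> Pts"
  shows "card (pencil R) = q + 1"
  using ex_line_not_through ex_pencil_bij[OF assms] bij_betw_same_card card_line by metis

lemma finite_pencil: "R \<in> Pts \<Longrightarrow> finite (pencil R)"
  using card_pencil by (intro card_ge_0_finite) simp

lemma finite_points: "finite Pts"
proof (cases "Pts = {}")
  case False
  then obtain R where R: "R \<in> Pts"
    by blast
  have "Pts \<subseteq> insert R (\<Union>(pencil R))"
    using ex_pencil_line[OF R] by blast
  moreover have "finite (\<Union>(pencil R))"
    using finite_pencil[OF R] finite_line by (auto simp: pencil_def)
  ultimately show ?thesis
    by (meson finite_insert finite_subset)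
qed simp

text \<open>This excludes the exponent 0 in \<open>q = p ^ n\<close>, so that \<open>p\<close>
  divides \<open>q\<close>. If lines had two points, the line joining \<open>w\<close> and
  \<open>x\<close> would meet the line \<open>yz\<close> in \<open>w\<close> or \<open>x\<close>,
  making three points of the quadrangle collinear.\<close>

lemma order_ne_1: "q \<noteq> 1"
proof
  assume "q = 1"
  obtain F where F: "F \<subseteq> Pts" "card F = 4" "\<And>l. l \<in> Lns \<Longrightarrow> card (F \<inter> l) \<le> 2"
    using quadrangle by blast
  have fin: "finite F"
    using F(2) by (intro card_ge_0_finite) simp
  obtain w G where "F = insert w G" "w \<notin> G" "card G = 3"
    using F(2) by (metis card_Suc_eq eval_nat_numeral(2) semiring_norm(26,27))
  then obtain x y z where F_eq: "F = {w, x, y, z}" "distinct [w, x, y, z]"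
    by (auto simp: card_3_iff)
  obtain l where l: "l \<in> Lns" "w \<in> l" "x \<in> l"
    using obtain_join[of w x] F(1) F_eq by auto
  obtain k where k: "k \<in> Lns" "y \<in> k" "z \<in> k"
    using obtain_join[of y z] F(1) F_eq by auto
  have "{w, x} = l"
    using l F_eq card_line[OF l(1)] \<open>q = 1\<close> finite_line
    by (intro card_subset_eq) auto
  then have "l \<noteq> k"
    using k F_eq by auto
  then obtain v where v: "v \<in> l" "v \<in> k"
    using meet l k by blast
  then have "{v, y, z} \<subseteq> F \<inter> k" "card {v, y, z} = 3"
    using k F_eq \<open>{w, x} = l\<close> by auto
  then have "3 \<le> card (F \<inter> k)"
    using fin by (metis card_mono finite_Int)
  then show False
    using F(3)[OF k(1)] by simp
qed

text \<open>A point of \<open>A\<close> other than \<open>R\<close> lies on exactly one line of the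
  pencil, while \<open>R\<close> lies on all \<open>q + 1\<close> of them; hence the sum is
  \<open>(card A - 1) + (q + 1)\<close>.\<close>

lemma sum_pencil_card:
  assumes "R \<in> A" "A \<subseteq> Pts"
  shows "(\<Sum>l\<in>pencil R. card (A \<inter> l)) = card A + q"
proof -
  have R: "R \<in> Pts" and fin: "finite A"
    using assms finite_points finite_subset by auto
  have "A - {R} = (\<Union>l\<in>pencil R. A \<inter> l - {R})"
    using ex_pencil_line[OF R] assms by blast
  then have "card (A - {R}) = card (\<Union>l\<in>pencil R. A \<inter> l - {R})"
    by simp
  also have "\<dots> = (\<Sum>l\<in>pencil R. card (A \<inter> l - {R}))"
  proof (rule card_UN_disjoint)
    show "\<forall>l\<in>pencil R. \<forall>k\<in>pencil R. l \<noteq> k \<longrightarrow> (A \<inter> l - {R}) \<inter> (A \<inter> k - {R}) = {}"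
      unfolding pencil_def using line_eqI by blast
  qed (use fin finite_pencil[OF R] in auto)
  finally have *: "card (A - {R}) = (\<Sum>l\<in>pencil R. card (A \<inter> l - {R}))" .
  have "(\<Sum>l\<in>pencil R. card (A \<inter> l)) = (\<Sum>l\<in>pencil R. card (A \<inter> l - {R}) + 1)"
  proof (rule sum.cong)
    fix l
    assume "l \<in> pencil R"
    then have "R \<in> A \<inter> l"
      using assms by (auto simp: pencil_def)
    from card_Suc_Diff1[OF _ this] show "card (A \<inter> l) = card (A \<inter> l - {R}) + 1"
      using fin by simp
  qed simp
  also have "\<dots> = card (A - {R}) + card (pencil R)"
    by (simp add: sum.distrib * del: add_Suc_right One_nat_def)
  also have "\<dots> = card A + q"
    using card_Suc_Diff1[OF fin assms(1)] card_pencil[OF R] by simp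
  finally show ?thesis .
qed

text \<open>Needed for the degenerate case of a collinear \<open>A\<close>, in which no point off
  the line is available for joining.\<close>

lemma card_inter_1_if_subset_line:
  assumes "A \<subseteq> k" "k \<in> Lns" "l \<in> Lns" "l \<noteq> k" "R \<in> A" "R \<in> l"
  shows "card (A \<inter> l) = 1"
proof -
  have "A \<inter> l = {R}"
    using assms line_eqI[of l k] by blast
  then show ?thesis
    by simp
qed

lemma ex_another_line_through:
  assumes "q \<ge> 1" "R \<in> Pts"
  shows "\<exists>k\<in>Lns. R \<in> k \<and> k \<noteq> l"
proof (rule ccontr)
  assume "\<not> ?thesis"
  then have "pencil R \<subseteq> {l}"
    by (auto simp: pencil_def)
  then have "card (pencil R) \<le> 1"
    using card_mono[of "{l}" "pencil R"] by simp
  then show False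
    using card_pencil assms by simp
qed

end

section \<open>The point set \<open>A\<close> and its regular points\<close>

locale renitent_point_set = projective_plane_of_order Pts Lns q
  for Pts :: "'a set" and Lns :: "'a set set" and q :: nat +
  fixes p :: nat and A :: "'a set" and m t :: "'a \<Rightarrow> nat"
  assumes p_dvd: "p dvd q" and q_pos: "q \<ge> 1" and A_subset: "A \<subset> Pts"
    and residues_less: "R \<in> A \<Longrightarrow> m R < p \<and> t R < p"
    and at_most_one: "R \<in> A \<Longrightarrow> \<exists>\<^sub>\<le>\<^sub>1 l. R \<in> l \<and> mod_secant Lns p A (t R) l"
    and others: "\<lbrakk>R \<in> A; l \<in> Lns; R \<in> l; \<not> mod_secant Lns p A (t R) l\<rbrakk>
           \<Longrightarrow> mod_secant Lns p A (m R) l"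
begin

abbreviation residue :: "'a set \<Rightarrow> nat" where
  "residue l \<equiv> card (A \<inter> l) mod p"

abbreviation regular :: "'a \<Rightarrow> bool" where
  "regular \<equiv> regular_point Lns p q A m t"

abbreviation irregular :: "'a \<Rightarrow> bool" where
  "irregular \<equiv> irregular_point Lns p q A m t"

definition a :: nat where
  "a = card A mod p"

lemma A_Pts: "R \<in> A \<Longrightarrow> R \<in> Pts"
  using A_subset by auto

lemma finite_A: "finite A"
  using A_subset finite_points finite_subset by auto

lemma mod_secant_t: "R \<in> A \<Longrightarrow> mod_secant Lns p A (t R) l \<longleftrightarrow> l \<in> Lns \<and> residue l = t R"
  using residues_less by (auto simp: mod_secant_def cong_def)

lemma mod_secant_m: "R \<in> A \<Longrightarrow> mod_secant Lns p A (m R) l \<longleftrightarrow> l \<in> Lns \<and> residue l = m R"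
  using residues_less by (auto simp: mod_secant_def cong_def)

lemma t_line_unique:
  "\<lbrakk>R \<in> A; l \<in> Lns; k \<in> Lns; R \<in> l; R \<in> k; residue l = t R; residue k = t R\<rbrakk> \<Longrightarrow> l = k"
  using at_most_one[of R] by (auto simp: Uniq_def mod_secant_t)

lemma residue_cases:
  "\<lbrakk>R \<in> A; l \<in> Lns; R \<in> l\<rbrakk> \<Longrightarrow> residue l = t R \<or> residue l = m R"
  using others by (auto simp: mod_secant_t mod_secant_m)

text \<open>Otherwise all lines through \<open>R\<close> would have residue \<open>t R\<close>;
  there are at least two, but at most one may have this residue.\<close>

lemma m_ne_t:
  assumes "R \<in> A"
  shows "m R \<noteq> t R"
proof
  assume "m R = t R"
  then have *: "residue l = t R" if "l \<in> Lns" "R \<in> l" for l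
    using residue_cases[OF assms] that by auto
  show False
    using ex_another_line_through[OF q_pos A_Pts[OF assms]] * t_line_unique[OF assms] by metis
qed

text \<open>Existence of one line of residue \<open>t R\<close> suffices: it is then unique, and
  since \<open>m R \<noteq> t R\<close> the lines of residue \<open>m R\<close> are exactly the
  other \<open>q\<close> lines of the pencil.\<close>

lemma regular_iff:
  "regular R \<longleftrightarrow> R \<in> A \<and> (\<exists>l\<in>Lns. R \<in> l \<and> residue l = t R)"
proof
  assume "regular R"
  then have *: "R \<in> A" "card {l. R \<in> l \<and> mod_secant Lns p A (t R) l} = 1"
    by (auto simp: regular_point_def)
  then obtain l where "R \<in> l \<and> mod_secant Lns p A (t R) l"
    by (auto simp: card_1_singleton_iff)
  then show "R \<in> A \<and> (\<exists>l\<in>Lns. R \<in> l \<and> residue l = t R)"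
    using * by (auto simp: mod_secant_t)
next
  assume "R \<in> A \<and> (\<exists>l\<in>Lns. R \<in> l \<and> residue l = t R)"
  then obtain l where R: "R \<in> A" and l: "l \<in> Lns" "R \<in> l" "residue l = t R"
    by blast
  have "{l. R \<in> l \<and> mod_secant Lns p A (t R) l} = {l}"
    using l t_line_unique[OF R] by (auto simp: mod_secant_t[OF R])
  moreover have "{l. R \<in> l \<and> mod_secant Lns p A (m R) l} = pencil R - {l}"
  proof -
    have "residue k = m R \<longleftrightarrow> k \<noteq> l" if "k \<in> Lns" "R \<in> k" for k
      using residue_cases[OF R that] t_line_unique[OF R] l m_ne_t[OF R] that by metis
    then show ?thesis
      by (auto simp: mod_secant_m[OF R] pencil_def)
  qed
  ultimately show "regular R"
    using R l card_pencil[OF A_Pts[OF R]] by (auto simp: regular_point_def pencil_def)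
qed

section \<open>Residues on the lines through irregular and regular points\<close>

lemma irregular_iff: "irregular R \<longleftrightarrow> R \<in> A \<and> \<not> regular R"
  by (simp add: irregular_point_def)

lemma sum_pencil_residue:
  assumes "R \<in> A"
  shows "(\<Sum>l\<in>pencil R. residue l) mod p = a"
proof -
  have "(\<Sum>l\<in>pencil R. residue l) mod p = (card A + q) mod p"
    using sum_pencil_card[OF assms] A_subset by (simp add: mod_sum_eq psubset_imp_subset)
  then show ?thesis
    using p_dvd by (auto simp: a_def)
qed

lemma mod_add_order_mult: "(i + q * j) mod p = i mod p"
  using p_dvd by (metis dvd_def mod_mult_self2 mult.assoc)

text \<open>No line through \<open>R\<close> has residue \<open>t R\<close>, so all
  \<open>q + 1\<close> have residue \<open>m R\<close>, and the pencil sum is \<open>m R\<close>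
  modulo \<open>p\<close>.\<close>

lemma irregular_residue:
  assumes "irregular R" "l \<in> Lns" "R \<in> l"
  shows "residue l = a"
proof -
  have R: "R \<in> A" and *: "\<And>k. \<lbrakk>k \<in> Lns; R \<in> k\<rbrakk> \<Longrightarrow> residue k = m R"
    using assms(1) residue_cases by (auto simp: irregular_iff regular_iff)
  have "(\<Sum>l\<in>pencil R. residue l) = (\<Sum>l\<in>pencil R. m R)"
    by (rule sum.cong) (auto simp: pencil_def *)
  also have "\<dots> = m R + q * m R"
    using card_pencil[OF A_Pts[OF R]] by simp
  finally have "a = m R mod p"
    using sum_pencil_residue[OF R] mod_add_order_mult by simp
  then show ?thesis
    using *[OF assms(2,3)] residues_less[OF R] by simp
qed

text \<open>One line contributes \<open>t R\<close> to the pencil sum, and the other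
  \<open>q\<close> lines contribute \<open>q * m R\<close>, which vanishes modulo
  \<open>p\<close>.\<close>

lemma regular_t:
  assumes "regular R"
  shows "t R = a"
proof -
  obtain l where R: "R \<in> A" and l: "l \<in> Lns" "R \<in> l" "residue l = t R"
    using assms by (auto simp: regular_iff)
  have lp: "l \<in> pencil R" and fin: "finite (pencil R)"
    using l finite_pencil[OF A_Pts[OF R]] by (auto simp: pencil_def)
  have "(\<Sum>l\<in>pencil R. residue l) = t R + (\<Sum>l\<in>pencil R - {l}. residue l)"
    using sum.remove[OF fin lp, of residue] l by simp
  also have "(\<Sum>l\<in>pencil R - {l}. residue l) = (\<Sum>l\<in>pencil R - {l}. m R)"
  proof (rule sum.cong)
    fix k
    assume "k \<in> pencil R - {l}"
    then show "residue k = m R"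
      using residue_cases[OF R] t_line_unique[OF R] l by (auto simp: pencil_def)
  qed simp
  also have "\<dots> = q * m R"
    using card_pencil[OF A_Pts[OF R]] lp by simp
  finally have "a = t R mod p"
    using sum_pencil_residue[OF R] mod_add_order_mult by simp
  then show ?thesis
    using residues_less[OF R] by simp
qed

section \<open>Uniqueness of the irregular point and constancy of \<open>m\<close> on regular
  points\<close>

lemma regular_m_ne: "regular R \<Longrightarrow> m R \<noteq> a"
  using m_ne_t regular_t by (auto simp: regular_iff)

lemma regular_residue_cases:
  "\<lbrakk>regular R; l \<in> Lns; R \<in> l\<rbrakk> \<Longrightarrow> residue l = a \<or> residue l = m R"
  using residue_cases regular_t by (metis regular_iff)

lemma regular_a_line_unique:
  "\<lbrakk>regular R; l \<in> Lns; k \<in> Lns; R \<in> l; R \<in> k; residue l = a; residue k = a\<rbrakk> \<Longrightarrow> l = k"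
  using t_line_unique[of R l k] regular_t[of R] by (auto simp: regular_iff)

lemma regular_a_line_ex: "regular R \<Longrightarrow> \<exists>l\<in>Lns. R \<in> l \<and> residue l = a"
  using regular_t[of R] by (auto simp: regular_iff)

lemma regular_m_eq_if_residue_ne:
  assumes "regular P" "regular R" "l \<in> Lns" "P \<in> l" "R \<in> l" "residue l \<noteq> a"
  shows "m P = m R"
  using regular_residue_cases assms by metis

text \<open>A line of residue \<open>m R\<close> through \<open>R\<close> either differs from
  \<open>l\<close> and meets \<open>A\<close> in \<open>R\<close> alone, or is \<open>l\<close>
  itself; the latter contains all of \<open>A\<close> and so has residue \<open>a\<close>,
  contradicting \<open>m R \<noteq> a\<close>.\<close>

lemma regular_m_if_subset_line:
  assumes "A \<subseteq> l" "l \<in> Lns" "regular R"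
  shows "m R = 1 mod p"
proof -
  have R: "R \<in> A"
    using assms by (simp add: regular_iff)
  obtain k where k: "k \<in> Lns" "R \<in> k" "residue k = m R"
  proof -
    obtain l' where l': "l' \<in> Lns" "R \<in> l'" "residue l' = a"
      using regular_a_line_ex[OF assms(3)] by blast
    obtain k where "k \<in> Lns" "R \<in> k" "k \<noteq> l'"
      using ex_another_line_through[OF q_pos A_Pts[OF R]] by blast
    then show thesis
      using that regular_residue_cases[OF assms(3)] regular_a_line_unique[OF assms(3)] l' by metis
  qed
  show ?thesis
  proof (cases "k = l")
    case False
    then show ?thesis
      using card_inter_1_if_subset_line[OF assms(1,2) k(1) _ R k(2)] k(3) by simp
  next
    case True
    then have "A \<inter> k = A"
      using assms by auto
    then show ?thesis
      using k regular_m_ne[OF assms(3)] by (simp add: a_def)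
  qed
qed

text \<open>Two irregular points force \<open>A\<close> onto their join \<open>l\<close>. Any other
  line through \<open>Q\<close> is then a tangent, so \<open>a\<close> is the residue of 1, which is
  also \<open>m R\<close>; but \<open>m R \<noteq> a\<close>.\<close>

lemma irregular_unique:
  assumes "regular R" "irregular Q" "irregular Q'"
  shows "Q = Q'"
proof (rule ccontr)
  assume "Q \<noteq> Q'"
  have in_A: "R \<in> A" "Q \<in> A" "Q' \<in> A" and ne: "R \<noteq> Q" "R \<noteq> Q'"
    using assms by (auto simp: regular_iff irregular_iff)
  obtain l where l: "l \<in> Lns" "Q \<in> l" "Q' \<in> l"
    using obtain_join A_Pts in_A \<open>Q \<noteq> Q'\<close> by metis
  \<comment> \<open>The lines \<open>SX\<close> and \<open>SY\<close> both have residue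
    \<open>a\<close>, hence coincide at the regular point \<open>S\<close> and equal the line
    \<open>XY\<close>.\<close>
  have regular_on: "S \<in> k"
    if "regular S" "irregular X" "irregular Y" "X \<noteq> Y" "k \<in> Lns" "X \<in> k" "Y \<in> k" for S X Y k
  proof -
    have *: "S \<in> A" "X \<in> A" "Y \<in> A" "S \<noteq> X" "S \<noteq> Y"
      using that by (auto simp: regular_iff irregular_iff)
    obtain u where u: "u \<in> Lns" "S \<in> u" "X \<in> u"
      using obtain_join A_Pts * by metis
    obtain v where v: "v \<in> Lns" "S \<in> v" "Y \<in> v"
      using obtain_join A_Pts * by metis
    have "u = v"
      using regular_a_line_unique[OF that(1)] irregular_residue that u v by metis
    then have "u = k"
      using line_eqI[of u k X Y] that u v by auto
    then show ?thesis
      using u by simp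
  qed
  have "R \<in> l"
    using regular_on[OF assms \<open>Q \<noteq> Q'\<close> l] .
  have "A \<subseteq> l"
  proof
    fix S
    assume "S \<in> A"
    show "S \<in> l"
    proof (cases "regular S")
      case True
      then show ?thesis
        using regular_on[OF _ assms(2,3) \<open>Q \<noteq> Q'\<close> l] by simp
    next
      case False
      then have S: "irregular S"
        using \<open>S \<in> A\<close> by (simp add: irregular_iff)
      show ?thesis
      proof (cases "S = Q")
        case False
        then obtain k where k: "k \<in> Lns" "Q \<in> k" "S \<in> k"
          using obtain_join A_Pts in_A \<open>S \<in> A\<close> by metis
        \<comment> \<open>The same argument applied to the irregular pair \<open>Q\<close>,
          \<open>S\<close> puts \<open>R\<close> on their join, which is therefore the line
          \<open>QR\<close>, that is \<open>l\<close>.\<close>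
        have "R \<in> k"
          using regular_on[OF assms(1,2) S _ k] False by auto
        then have "k = l"
          using line_eqI[OF k(1) l(1) ne(1)] k l \<open>R \<in> l\<close> by simp
        then show ?thesis
          using k by simp
      qed (use l in simp)
    qed
  qed
  obtain k where k: "k \<in> Lns" "Q \<in> k" "k \<noteq> l"
    using ex_another_line_through[OF q_pos A_Pts[OF in_A(2)]] by blast
  have "residue k = 1 mod p"
    using card_inter_1_if_subset_line[OF \<open>A \<subseteq> l\<close> l(1) k(1,3) in_A(2) k(2)] by simp
  then show False
    using irregular_residue[OF assms(2) k(1,2)] regular_m_if_subset_line[OF \<open>A \<subseteq> l\<close> l(1) assms(1)]
      regular_m_ne[OF assms(1)] by simp
qed

text \<open>A line of residue other than \<open>a\<close> transfers the value of \<open>m\<close>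
  between its regular points. If the line \<open>PR\<close> has residue \<open>a\<close>, the
  transfer goes through a point \<open>S\<close> of \<open>A\<close> off this line; if there is no
  such point, both values are the residue of 1.\<close>

lemma regular_m_eq:
  assumes "regular P" "regular R"
  shows "m P = m R"
proof (cases "P = R")
  case False
  have in_A: "P \<in> A" "R \<in> A"
    using assms by (auto simp: regular_iff)
  obtain l where l: "l \<in> Lns" "P \<in> l" "R \<in> l"
    using obtain_join A_Pts in_A False by metis
  show ?thesis
  proof (cases "residue l = a")
    case False
    then show ?thesis
      using regular_m_eq_if_residue_ne assms l by blast
  next
    case True
    show ?thesis
    proof (cases "A \<subseteq> l")
      case True
      then show ?thesis
        using regular_m_if_subset_line assms l by simp
    next
      case False
      then obtain S where S: "S \<in> A" "S \<notin> l"
        by blast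
      obtain u where u: "u \<in> Lns" "P \<in> u" "S \<in> u"
        using obtain_join A_Pts in_A S l by metis
      obtain v where v: "v \<in> Lns" "R \<in> v" "S \<in> v"
        using obtain_join A_Pts in_A S l by metis
      \<comment> \<open>\<open>l\<close> is the only line of residue \<open>a\<close> through
        \<open>P\<close> and through \<open>R\<close>, and \<open>S\<close> is not on it. An
        irregular \<open>S\<close> would give \<open>u\<close> residue \<open>a\<close>, so
        \<open>S\<close> is regular.\<close>
      have ne: "residue u \<noteq> a" "residue v \<noteq> a"
        using regular_a_line_unique assms l u v S True by metis+
      then have "regular S"
        using irregular_residue[of S u] u S by (auto simp: irregular_iff)
      then show ?thesis
        using regular_m_eq_if_residue_ne ne assms u v by metis
    qed
  qed
qed simp

section \<open>The three cases of the classification\<close>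

lemma all_regular:
  assumes "\<forall>R\<in>A. regular R" "A \<noteq> {}"
  shows "\<exists>m0 t0. m0 \<noteq> t0 \<and> (\<forall>R\<in>A. m R = m0 \<and> t R = t0) \<and> mod_KM_arc Pts Lns p m0 t0 A"
proof -
  obtain P where P: "P \<in> A" "regular P"
    using assms by blast
  have eq: "m R = m P" "t R = a" if "R \<in> A" for R
    using assms that P regular_m_eq regular_t by auto
  have less: "m P < p" "a < p"
    using residues_less[OF P(1)] eq[OF P(1)] by auto
  have "\<exists>l. R \<in> l \<and> mod_secant Lns p A a l \<and>
      (\<forall>k\<in>Lns. R \<in> k \<and> k \<noteq> l \<longrightarrow> mod_secant Lns p A (m P) k)" if R: "R \<in> A" for R
  proof -
    have reg: "regular R"
      using assms R by blast
    obtain l where l: "l \<in> Lns" "R \<in> l" "residue l = a"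
      using regular_a_line_ex[OF reg] by blast
    have "mod_secant Lns p A (m P) k" if "k \<in> Lns" "R \<in> k" "k \<noteq> l" for k
      using regular_residue_cases[OF reg that(1,2)] regular_a_line_unique[OF reg that(1) l(1)]
        that l eq(1)[OF R] mod_secant_m[OF R] by auto
    moreover have "mod_secant Lns p A a l"
      using l less by (simp add: mod_secant_def cong_def)
    ultimately show ?thesis
      using l by blast
  qed
  then have "mod_KM_arc Pts Lns p (m P) a A"
    using A_subset assms(2) less by (simp add: mod_KM_arc_def)
  then show ?thesis
    using eq regular_m_ne[OF P(2)] by blast
qed

lemma all_irregular:
  assumes "\<forall>R\<in>A. irregular R" "p > 0"
  shows "mod_intersecting Pts Lns p a A"
proof -
  have "mod_secant Lns p A a l" if l: "l \<in> Lns" "A \<inter> l \<noteq> {}" for l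
  proof -
    obtain R where "R \<in> A" "R \<in> l"
      using l by blast
    then have "residue l = a"
      using irregular_residue assms l by blast
    then show ?thesis
      using l by (auto simp: mod_secant_def cong_def a_def)
  qed
  then show ?thesis
    using A_subset assms by (auto simp: mod_intersecting_def a_def)
qed

text \<open>The line \<open>RQ\<close> has residue \<open>a\<close>, and the renitent line at
  \<open>R\<close> is the only such line through \<open>R\<close>.\<close>

lemma renitent_through_irregular:
  assumes "irregular Q" "renitent_line Lns p q A m t R l"
  shows "Q \<in> l"
proof -
  have reg: "regular R" and "R \<in> l" "mod_secant Lns p A (t R) l"
    using assms(2) by (auto simp: renitent_line_def)
  then have l: "R \<in> l" "l \<in> Lns" "residue l = a"
    using mod_secant_t[of R l] regular_t[OF reg] by (auto simp: regular_point_def)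
  have in_A: "R \<in> A" "Q \<in> A" "R \<noteq> Q"
    using assms reg by (auto simp: regular_iff irregular_iff)
  obtain k where k: "k \<in> Lns" "R \<in> k" "Q \<in> k"
    using obtain_join A_Pts in_A by metis
  then have "k = l"
    using regular_a_line_unique[OF reg] l irregular_residue[OF assms(1)] by blast
  then show ?thesis
    using k by simp
qed

text \<open>After deletion, lines through \<open>Q\<close> have residue \<open>b\<close>, that of
  \<open>a - 1\<close>, and all other lines meeting the remaining set have residue
  \<open>m R\<close>. The two alternatives are \<open>m R \<noteq> b\<close> and
  \<open>m R = b\<close>.\<close>

lemma delete_irregular:
  assumes Q: "irregular Q" and reg: "\<And>S. S \<in> A \<Longrightarrow> S \<noteq> Q \<Longrightarrow> regular S" and R: "regular R"
  shows "(\<exists>m0 t0. m0 \<noteq> t0 \<and> mod_KM_arc Pts Lns p m0 t0 (A - {Q}) \<and>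
            concurrent Pts {l. proper_mod_secant Lns p (A - {Q}) t0 l}) \<or>
         (\<exists>c. mod_intersecting Pts Lns p c (A - {Q}))"
proof -
  define B where "B = A - {Q}"
  have QA: "Q \<in> A" and RB: "R \<in> B" and "B \<subset> Pts"
    using Q R A_subset by (auto simp: B_def regular_iff irregular_iff)
  have mp: "m R < p"
    using residues_less[of R] RB by (auto simp: B_def)
  \<comment> \<open>\<open>a + p - 1\<close> rather than \<open>a - 1\<close>, which would truncate when \<open>a = 0\<close>\<close>
  define b where "b = (a + p - 1) mod p"
  have bp: "b < p"
    using mp by (simp add: b_def)
  have through: "card (B \<inter> l) mod p = b" if "l \<in> Lns" "Q \<in> l" for l
  proof -
    have "A \<inter> l = insert Q (B \<inter> l)" "Q \<notin> B \<inter> l"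
      using that QA by (auto simp: B_def)
    then have "card (A \<inter> l) = card (B \<inter> l) + 1"
      using finite_A by (simp add: B_def)
    then have "a = (card (B \<inter> l) + 1) mod p"
      using irregular_residue[OF Q that] by simp
    then have "b = ((card (B \<inter> l) + 1) mod p + (p - 1)) mod p"
      using mp by (simp add: b_def)
    also have "\<dots> = (card (B \<inter> l) + 1 + (p - 1)) mod p"
      by (simp add: mod_simps)
    also have "\<dots> = card (B \<inter> l) mod p"
      using mp by simp
    finally show ?thesis
      by simp
  qed
  \<comment> \<open>The unique line of residue \<open>a\<close> through \<open>S\<close> is
    \<open>SQ\<close>, so \<open>l\<close> has residue \<open>m S\<close>, which equals
    \<open>m R\<close>; deleting \<open>Q\<close> does not affect \<open>l\<close>.\<close>
  have avoiding: "card (B \<inter> l) mod p = m R" if l: "l \<in> Lns" "Q \<notin> l" "S \<in> B" "S \<in> l" for l S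
  proof -
    have S: "regular S" "S \<in> A" "S \<noteq> Q"
      using that reg by (auto simp: B_def)
    obtain k where k: "k \<in> Lns" "S \<in> k" "Q \<in> k"
      using obtain_join A_Pts S QA by metis
    have "residue l \<noteq> a"
      using regular_a_line_unique[OF S(1) l(1) k(1)] irregular_residue[OF Q] k l by blast
    then have "residue l = m R"
      using regular_residue_cases[OF S(1)] regular_m_eq[OF S(1) R] l by auto
    moreover have "B \<inter> l = A \<inter> l"
      using l by (auto simp: B_def)
    ultimately show ?thesis
      by simp
  qed
  show ?thesis
  proof (cases "m R = b")
    case True
    have "card (B \<inter> l) mod p = b" if "l \<in> Lns" "B \<inter> l \<noteq> {}" for l
      using that through avoiding True by blast
    then have "mod_intersecting Pts Lns p b B"
      using \<open>B \<subset> Pts\<close> bp by (auto simp: mod_intersecting_def mod_secant_def cong_def)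
    then show ?thesis
      by (auto simp: B_def)
  next
    case False
    \<comment> \<open>The exceptional line at \<open>S\<close> is the join of \<open>S\<close> and
      \<open>Q\<close>.\<close>
    have "\<exists>l. S \<in> l \<and> mod_secant Lns p B b l \<and>
      (\<forall>k\<in>Lns. S \<in> k \<and> k \<noteq> l \<longrightarrow> mod_secant Lns p B (m R) k)" if S: "S \<in> B" for S
    proof -
      have SA: "S \<in> A" "S \<noteq> Q"
        using S by (auto simp: B_def)
      obtain l where l: "l \<in> Lns" "S \<in> l" "Q \<in> l"
        using obtain_join A_Pts SA QA by metis
      have "mod_secant Lns p B (m R) k" if k: "k \<in> Lns" "S \<in> k" "k \<noteq> l" for k
      proof -
        have "Q \<notin> k"
          using line_eqI[OF k(1) l(1) SA(2)] k l by blast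
        then show ?thesis
          using avoiding[OF k(1) _ S k(2)] k mp by (simp add: mod_secant_def cong_def)
      qed
      moreover have "mod_secant Lns p B b l"
        using through l bp by (simp add: mod_secant_def cong_def)
      ultimately show ?thesis
        using l by blast
    qed
    then have "mod_KM_arc Pts Lns p (m R) b B"
      using \<open>B \<subset> Pts\<close> RB mp bp by (auto simp: mod_KM_arc_def)
    \<comment> \<open>The common point is the deleted \<open>Q\<close>: a line meeting
      \<open>B\<close> but missing \<open>Q\<close> has residue \<open>m R\<close>, which differs
      from \<open>b\<close>.\<close>
    moreover have "Q \<in> l" if "proper_mod_secant Lns p B b l" for l
    proof (rule ccontr)
      assume "Q \<notin> l"
      moreover have "l \<in> Lns" "B \<inter> l \<noteq> {}" "card (B \<inter> l) mod p = b"
        using that bp by (auto simp: proper_mod_secant_def mod_secant_def cong_def)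
      ultimately show False
        using avoiding[of l] False by auto
    qed
    ultimately show ?thesis
      using False A_Pts[OF QA] by (auto simp: B_def concurrent_def)
  qed
qed

end

theorem theorem4p2:
  fixes Pts :: "'a set" and Lns :: "'a set set" and A :: "'a set"
    and p n q :: nat and m t :: "'a \<Rightarrow> nat"
  assumes "prime p" and "q = p ^ n"
    and "projective_plane_of_order Pts Lns q"
    and "A \<subset> Pts"
    and "\<And>R. R \<in> A \<Longrightarrow> m R < p \<and> t R < p"
    and "\<And>R. R \<in> A \<Longrightarrow> \<exists>\<^sub>\<le>\<^sub>1 l. R \<in> l \<and> mod_secant Lns p A (t R) l"
    and "\<And>R l. \<lbrakk>R \<in> A; l \<in> Lns; R \<in> l; \<not> mod_secant Lns p A (t R) l\<rbrakk>
           \<Longrightarrow> mod_secant Lns p A (m R) l"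
  shows
    "((\<forall>R\<in>A. regular_point Lns p q A m t R) \<and>
      (\<forall>P\<in>A. \<forall>R\<in>A. t P = t R \<and> m P = m R) \<and>
      (\<exists>m0 t0. m0 \<noteq> t0 \<and> (\<forall>R\<in>A. m R = m0 \<and> t R = t0) \<and> mod_KM_arc Pts Lns p m0 t0 A))
     \<or>
     ((\<forall>R\<in>A. irregular_point Lns p q A m t R) \<and>
      (\<exists>c. mod_intersecting Pts Lns p c A))
     \<or>
     (\<exists>Q. irregular_point Lns p q A m t Q \<and>
        (\<forall>Q'. irregular_point Lns p q A m t Q' \<longrightarrow> Q' = Q) \<and>
        (\<forall>R l. renitent_line Lns p q A m t R l \<longrightarrow> Q \<in> l) \<and>
        ((\<exists>m0 t0. m0 \<noteq> t0 \<and> mod_KM_arc Pts Lns p m0 t0 (A - {Q}) \<and>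
            concurrent Pts {l. proper_mod_secant Lns p (A - {Q}) t0 l}) \<or>
         (\<exists>c. mod_intersecting Pts Lns p c (A - {Q}))))"
proof -
  interpret plane: projective_plane_of_order Pts Lns q
    by fact
  have "n \<noteq> 0"
    using plane.order_ne_1 assms(2) by (cases n) auto
  then have "p dvd q" "q \<ge> 1" "p > 0"
    using assms(1,2) prime_gt_0_nat[of p] by (auto simp: Suc_le_eq)
  interpret renitent_point_set Pts Lns q p A m t
    using assms(4-7) \<open>p dvd q\<close> \<open>q \<ge> 1\<close> by unfold_locales auto
  \<comment> \<open>An empty \<open>A\<close> falls vacuously under \<open>irr\<close>, so
    \<open>reg\<close> may assume a point from which to read off the type.\<close>
  consider (irr) "\<forall>R\<in>A. irregular R" | (reg) "\<forall>R\<in>A. regular R" "A \<noteq> {}"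
    | (mixed) Q R where "irregular Q" "regular R"
    by (auto simp: irregular_iff)
  then show ?thesis
  proof cases
    case irr
    then show ?thesis
      using all_irregular[OF irr \<open>p > 0\<close>] by blast
  next
    case reg
    then show ?thesis
      using all_regular[OF reg] by metis
  next
    case mixed
    have unique: "\<forall>Q'. irregular Q' \<longrightarrow> Q' = Q"
      using irregular_unique[OF mixed(2)] mixed(1) by blast
    then have "\<And>S. S \<in> A \<Longrightarrow> S \<noteq> Q \<Longrightarrow> regular S"
      by (auto simp: irregular_iff)
    note del = delete_irregular[OF mixed(1) this mixed(2)]
    have "\<forall>R l. renitent_line Lns p q A m t R l \<longrightarrow> Q \<in> l"
      using renitent_through_irregular[OF mixed(1)] by blast
    with unique del mixed(1) show ?thesis
      by blast
  qed
qed

end
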